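(* Let $\gamma\in\mathbb C$, $p,q\in\mathbb C\setminus\{0\}$, $M,N,n\in\mathbb N_0$ with $n\le N\le M$, and $t\in\mathbb C$ with $|t|<1$. Then $$\sum_{x=0}^M\binom{M}{x}q^x(1-q)^{M-x}\left[(1-t)^{-\gamma}{}_2F_1\!\left(\begin{matrix}\gamma,\,-x\\ -N\end{matrix};\frac{t}{p(t-1)}\right)\right]_N K_n(x;q,M)=\frac{(\gamma)_n}{(-N)_n}\left(\frac{t(q-1)}{p}\right)^n\left[(1-t)^{-\gamma-n}{}_2F_1\!\left(\begin{matrix}\gamma+n,\,n-M\\ n-N\end{matrix};\frac{-qt}{p(1-t)}\right)\right]_{N-n}.$$
   Context: $\mathbb N_0=\{0,1,2,\dots\}$. Pochhammer symbol: $(a)_n=a(a+1)\cdots(a+n-1)$, $(a)_0=1$. ${}_2F_1\!\left(\begin{matrix}a,\,b\\ c\end{matrix};z\right)=\sum_{k\ge0}\frac{(a)_k(b)_k}{(c)_k}\frac{z^k}{k!}$. Truncated Maclaurin expansion in $t$: $[f(t)]_N=\sum_{k=0}^N\frac{f^{(k)}(0)}{k!}t^k$, i.e. the partial sum through degree $N$ of the power series of $f$ in $t$ about $t=0$. When the hypergeometric series inside $[\cdot]_L$ has lower parameter $-L$, only its terms of index $\le L$ (which are well defined) contribute to powers of $t$ of degree $\le L$, and the bracket is computed from these terms only. Krawtchouk polynomials, for $0\le n\le M$: $K_n(x;q,M)=\sum_{k=0}^n\frac{(-n)_k(-x)_k}{(-M)_k\,k!}\,q^{-k}$ (the ${}_2F_1(-n,-x;-M;1/q)$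 understood as the sum up to index $n$). Convention: $0^0=1$. *)

theory Defs
  imports "HOL-Analysis.Analysis"
begin

definition maclaurin_trunc :: "nat \<Rightarrow> (complex \<Rightarrow> complex) \<Rightarrow> complex \<Rightarrow> complex" where
  "maclaurin_trunc N f t = (\<Sum>k\<le>N. (deriv ^^ k) f 0 / fact k * t ^ k)"

text \<open>
  The terms of index at most \<open>L\<close> of the Gauss hypergeometric series. For the lower parameter
  \<open>c = - L\<close> these are exactly the well-defined terms, since \<open>pochhammer (- L) k = 0\<close> iff \<open>k > L\<close>.
\<close>
definition hyp2F1_upto :: "nat \<Rightarrow> complex \<Rightarrow> complex \<Rightarrow> complex \<Rightarrow> complex \<Rightarrow> complex" where
  "hyp2F1_upto L a b c z =
     (\<Sum>k\<le>L. pochhammer a k * pochhammer b k / pochhammer c k * (z ^ k / fact k))"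

text \<open>Meaningful for \<open>n \<le> M\<close> and \<open>q \<noteq> 0\<close>.\<close>
definition krawtchouk :: "nat \<Rightarrow> complex \<Rightarrow> complex \<Rightarrow> nat \<Rightarrow> complex" where
  "krawtchouk n x q M = hyp2F1_upto n (- of_nat n) (- x) (- of_nat M) (1 / q)"

end

theory Submission
  imports Defs
begin

text \<open>
  Write \<open>w x\<close> for the binomial weight \<open>binom(M, x) q^x (1 - q)^(M - x)\<close>. Everything rests on the mixed
  moments \<open>E(k, n) = \<Sum>x. w x * binom(x, k) * K_n(x)\<close>. For fixed \<open>x\<close>, the generating function of the
  Krawtchouk polynomials is \<open>\<Sum>n. binom(M, n) K_n(x) u^n = (1 + u)^(M - x) (1 + u - u/q)^x\<close>.
  Averaging it against \<open>w x * binom(x, k)\<close> gives a binomial sum in \<open>A = q (1 + u - u/q)\<close> and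
  \<open>B = (1 - q) (1 + u)\<close>. Since \<open>A + B = 1\<close>, this sum collapses to
  \<open>binom(M, k) (q + (q - 1) u)^k\<close>, and comparing coefficients of \<open>u^n\<close> yields
  \<open>binom(M, n) E(k, n) = binom(M, k) binom(k, n) q^(k - n) (q - 1)^n\<close>
  (lemma \<open>krawtchouk_binomial_moment\<close>). In particular \<open>E(k, n) = 0\<close> for \<open>k < n\<close>, which is the
  orthogonality of \<open>K_n\<close> to polynomials of lower degree.

  Both brackets have the form \<open>(1 - s)^(-a) 2F1(a, b; c; v s / (1 - s))\<close>, whose \<open>k\<close>-th term is a
  constant times \<open>s^k (1 - s)^(-a - k)\<close>. Truncating at degree \<open>L\<close> therefore leaves
  \<open>t^k [(1 - t)^(-a - k)]_(L - k)\<close> (lemma \<open>maclaurin_trunc_hyp2F1\<close>). On the left-hand side only the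
  \<open>k\<close>-th constant depends on \<open>x\<close>, through \<open>(-x)_k = (-1)^k k! binom(x, k)\<close>, so summing over \<open>x\<close>
  replaces it by the moment \<open>E(k, n)\<close>. The terms \<open>k < n\<close> vanish, and after the substitution
  \<open>k = n + i\<close> the remaining ones are exactly the terms of the right-hand side, because
  \<open>(\<gamma>)_(n+i) = (\<gamma>)_n (\<gamma> + n)_i\<close> and \<open>binom(M, n+i) binom(n+i, n) = binom(M, n) binom(M - n, i)\<close>.
\<close>

section \<open>Mixed moments of Krawtchouk polynomials\<close>

lemma pochhammer_minus_of_nat:
  "pochhammer (- of_nat n :: 'a::field_char_0) k = (- 1) ^ k * fact k * of_nat (n choose k)"
  by (simp add: binomial_gbinomial gbinomial_pochhammer)

text \<open>
  The binomial theorem differentiated \<open>j\<close> times in \<open>a\<close>, up to the factor \<open>a^j / j!\<close>.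
\<close>
lemma binomial_theorem_choose_weighted:
  fixes a b :: "'a::comm_ring_1"
  shows "(\<Sum>m\<le>M. of_nat (M choose m) * of_nat (m choose j) * a ^ m * b ^ (M - m))
           = of_nat (M choose j) * a ^ j * (a + b) ^ (M - j)"
proof (cases "j \<le> M")
  case True
  have "(\<Sum>m\<le>M. of_nat (M choose m) * of_nat (m choose j) * a ^ m * b ^ (M - m))
      = (\<Sum>m\<in>{j..M}. of_nat (M choose m) * of_nat (m choose j) * a ^ m * b ^ (M - m))"
    by (rule sum.mono_neutral_right) (auto simp: binomial_eq_0)
  also have "\<dots> = (\<Sum>i\<le>M - j. of_nat (M choose j) * a ^ j * (of_nat (M - j choose i) * a ^ i * b ^ (M - j - i)))"
  proof (rule sum.reindex_bij_witness[where i = "\<lambda>i. i + j" and j = "\<lambda>m. m - j"])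
    fix m assume m: "m \<in> {j..M}"
    have "of_nat (M choose m) * of_nat (m choose j)
        = (of_nat (M choose j) * of_nat (M - j choose (m - j)) :: 'a)"
      using m by (simp add: choose_mult flip: of_nat_mult)
    moreover have "a ^ m = a ^ j * a ^ (m - j)" "M - j - (m - j) = M - m"
      using m by (simp_all flip: power_add)
    ultimately show "of_nat (M choose j) * a ^ j * (of_nat (M - j choose (m - j)) * a ^ (m - j) * b ^ (M - j - (m - j)))
        = of_nat (M choose m) * of_nat (m choose j) * a ^ m * b ^ (M - m)"
      by (simp add: mult_ac)
  qed (use True in auto)
  also have "\<dots> = of_nat (M choose j) * a ^ j * (a + b) ^ (M - j)"
    by (simp add: binomial_ring sum_distrib_left)
  finally show ?thesis .
qed (auto simp: binomial_eq_0 intro!: sum.neutral)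

text \<open>
  Extending the summation range from \<open>n\<close> to \<open>M\<close> makes it independent of \<open>n\<close>, so that sums over \<open>n\<close>
  and \<open>j\<close> can be exchanged freely.
\<close>
lemma krawtchouk_eq_sum_binomial:
  assumes "n \<le> M"
  shows "krawtchouk n (of_nat x) q M
           = (\<Sum>j\<le>M. of_nat (n choose j) * of_nat (x choose j) / of_nat (M choose j) * (- 1 / q) ^ j)"
proof -
  have "krawtchouk n (of_nat x) q M
      = (\<Sum>j\<le>n. of_nat (n choose j) * of_nat (x choose j) / of_nat (M choose j) * (- 1 / q) ^ j)"
    unfolding krawtchouk_def hyp2F1_upto_def
    by (intro sum.cong refl) (simp add: pochhammer_minus_of_nat power_divide minus_one_power_iff)
  also have "\<dots> = (\<Sum>j\<le>M. of_nat (n choose j) * of_nat (x choose j) / of_nat (M choose j) * (- 1 / q) ^ j)"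
    using assms by (intro sum.mono_neutral_left) auto
  finally show ?thesis .
qed

lemma krawtchouk_generating_function:
  assumes "x \<le> M"
  shows "(\<Sum>n\<le>M. of_nat (M choose n) * krawtchouk n (of_nat x) q M * u ^ n)
           = (1 + u) ^ (M - x) * (1 + u - u / q) ^ x"
proof -
  have "(\<Sum>n\<le>M. of_nat (M choose n) * krawtchouk n (of_nat x) q M * u ^ n)
      = (\<Sum>n\<le>M. \<Sum>j\<le>M. of_nat (x choose j) / of_nat (M choose j) * (- 1 / q) ^ j
            * (of_nat (M choose n) * of_nat (n choose j) * u ^ n * 1 ^ (M - n)))"
    by (intro sum.cong refl)
       (simp add: krawtchouk_eq_sum_binomial sum_distrib_left sum_distrib_right mult_ac)
  also have "\<dots> = (\<Sum>j\<le>M. of_nat (x choose j) / of_nat (M choose j) * (- 1 / q) ^ j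
            * (\<Sum>n\<le>M. of_nat (M choose n) * of_nat (n choose j) * u ^ n * 1 ^ (M - n)))"
    by (subst sum.swap) (simp add: sum_distrib_left)
  also have "\<dots> = (\<Sum>j\<le>M. of_nat (x choose j) * (- u / q) ^ j * (1 + u) ^ (M - j))"
    unfolding binomial_theorem_choose_weighted
    by (intro sum.cong refl) (simp add: power_divide power_minus' add.commute)
  also have "\<dots> = (\<Sum>j\<le>x. of_nat (x choose j) * (- u / q) ^ j * (1 + u) ^ (M - j))"
    using assms by (intro sum.mono_neutral_right) auto
  also have "\<dots> = (\<Sum>j\<le>x. (1 + u) ^ (M - x) * (of_nat (x choose j) * (- u / q) ^ j * (1 + u) ^ (x - j)))"
    using assms by (intro sum.cong refl) (auto simp: mult_ac simp flip: power_add)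
  also have "\<dots> = (1 + u) ^ (M - x) * (- u / q + (1 + u)) ^ x"
    by (simp only: binomial_ring[of "- u / q" "1 + u" x] sum_distrib_left)
  finally show ?thesis by (simp add: algebra_simps)
qed

text \<open>
  Averaging the generating function against the weights times \<open>binom(x, k)\<close> leaves
  \<open>binom(M, k)\<close> times the \<open>k\<close>-th power of a linear polynomial in \<open>u\<close>; both sides below are the
  coefficient of \<open>u^n\<close>.
\<close>
lemma krawtchouk_binomial_moment:
  assumes "q \<noteq> 0" "n \<le> M" "k \<le> M"
  shows "of_nat (M choose n)
           * (\<Sum>x\<le>M. of_nat (M choose x) * q ^ x * (1 - q) ^ (M - x) * of_nat (x choose k)
                * krawtchouk n (of_nat x) q M)
         = of_nat (M choose k) * of_nat (k choose n) * q ^ (k - n) * (q - 1) ^ n"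
proof -
  define W where "W x = of_nat (M choose x) * q ^ x * (1 - q) ^ (M - x) * of_nat (x choose k)" for x
  have "(\<Sum>m\<le>M. (of_nat (M choose m) * (\<Sum>x\<le>M. W x * krawtchouk m (of_nat x) q M)) * u ^ m)
      = (\<Sum>m\<le>M. (of_nat (M choose k) * of_nat (k choose m) * q ^ (k - m) * (q - 1) ^ m) * u ^ m)"
    for u
  proof -
    have "(\<Sum>m\<le>M. (of_nat (M choose m) * (\<Sum>x\<le>M. W x * krawtchouk m (of_nat x) q M)) * u ^ m)
        = (\<Sum>x\<le>M. W x * (\<Sum>m\<le>M. of_nat (M choose m) * krawtchouk m (of_nat x) q M * u ^ m))"
      unfolding sum_distrib_left sum_distrib_right
      by (subst sum.swap) (simp add: mult_ac)
    also have "\<dots> = (\<Sum>x\<le>M. of_nat (M choose x) * of_nat (x choose k)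
                       * (q * (1 + u - u / q)) ^ x * ((1 - q) * (1 + u)) ^ (M - x))"
      by (intro sum.cong refl, subst krawtchouk_generating_function)
         (simp_all add: W_def power_mult_distrib mult_ac)
    also have "\<dots> = of_nat (M choose k) * (q * (1 + u - u / q)) ^ k
                      * (q * (1 + u - u / q) + (1 - q) * (1 + u)) ^ (M - k)"
      by (rule binomial_theorem_choose_weighted)
    also have "q * (1 + u - u / q) + (1 - q) * (1 + u) = 1"
      using assms(1) by (simp add: field_simps)
    also have "q * (1 + u - u / q) = (q - 1) * u + q"
      using assms(1) by (simp add: field_simps)
    also have "of_nat (M choose k) * ((q - 1) * u + q) ^ k * 1 ^ (M - k)
        = (\<Sum>m\<le>k. (of_nat (M choose k) * of_nat (k choose m) * q ^ (k - m) * (q - 1) ^ m) * u ^ m)"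
      unfolding binomial_ring[of "(q - 1) * u"]
      by (simp add: sum_distrib_left power_mult_distrib mult_ac)
    also have "\<dots> = (\<Sum>m\<le>M. (of_nat (M choose k) * of_nat (k choose m) * q ^ (k - m) * (q - 1) ^ m) * u ^ m)"
      using assms(3) by (intro sum.mono_neutral_left) auto
    finally show ?thesis .
  qed
  then have "\<forall>m\<le>M. of_nat (M choose m) * (\<Sum>x\<le>M. W x * krawtchouk m (of_nat x) q M)
               = of_nat (M choose k) * of_nat (k choose m) * q ^ (k - m) * (q - 1) ^ m"
    by (intro iffD1[OF polyfun_eq_coeffs] allI)
  with assms(2) show ?thesis by (simp add: W_def)
qed

section \<open>Truncated Maclaurin expansions\<close>

lemma maclaurin_trunc_fps:
  assumes "f has_fps_expansion F"
  shows "maclaurin_trunc N f t = (\<Sum>k\<le>N. fps_nth F k * t ^ k)"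
  using fps_nth_fps_expansion[OF assms] by (simp add: maclaurin_trunc_def)

lemma maclaurin_trunc_sum:
  assumes "\<And>i. i \<in> A \<Longrightarrow> f i has_fps_expansion F i"
  shows "maclaurin_trunc N (\<lambda>s. \<Sum>i\<in>A. f i s) t = (\<Sum>i\<in>A. maclaurin_trunc N (f i) t)"
proof -
  have "maclaurin_trunc N (\<lambda>s. \<Sum>i\<in>A. f i s) t = (\<Sum>k\<le>N. \<Sum>i\<in>A. fps_nth (F i) k * t ^ k)"
    using maclaurin_trunc_fps[OF has_fps_expansion_sum[of A f F]] assms
    by (simp add: fps_sum_nth sum_distrib_right)
  also have "\<dots> = (\<Sum>i\<in>A. maclaurin_trunc N (f i) t)"
    by (subst sum.swap) (simp add: maclaurin_trunc_fps[OF assms])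
  finally show ?thesis .
qed

lemma maclaurin_trunc_cmult_power:
  assumes "f has_fps_expansion F" "k \<le> N"
  shows "maclaurin_trunc N (\<lambda>s. c * (s ^ k * f s)) t = c * t ^ k * maclaurin_trunc (N - k) f t"
proof -
  have "(\<lambda>s. c * (s ^ k * f s)) has_fps_expansion fps_const c * (fps_X ^ k * F)"
    by (intro fps_expansion_intros assms)
  then have "maclaurin_trunc N (\<lambda>s. c * (s ^ k * f s)) t
      = (\<Sum>m\<le>N. c * (if m < k then 0 else fps_nth F (m - k)) * t ^ m)"
    by (simp add: maclaurin_trunc_fps fps_X_power_mult_nth)
  also have "\<dots> = (\<Sum>m\<in>{k..N}. c * fps_nth F (m - k) * t ^ m)"
    by (rule sum.mono_neutral_cong_right) auto
  also have "\<dots> = (\<Sum>i\<le>N - k. c * t ^ k * (fps_nth F i * t ^ i))"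
    by (rule sum.reindex_bij_witness[where i = "\<lambda>i. i + k" and j = "\<lambda>m. m - k"])
       (use assms(2) in \<open>auto simp flip: power_add\<close>)
  also have "\<dots> = c * t ^ k * maclaurin_trunc (N - k) f t"
    by (simp add: maclaurin_trunc_fps[OF assms(1)] sum_distrib_left)
  finally show ?thesis .
qed

lemma has_fps_expansion_one_minus_powr:
  "(\<lambda>s::complex. (1 - s) powr a) has_fps_expansion Abs_fps (\<lambda>n. (a gchoose n) * (- 1) ^ n)"
proof (rule has_fps_expansionI)
  have "eventually (\<lambda>u::complex. u \<in> ball 0 1) (nhds 0)"
    by (intro eventually_nhds_in_open) auto
  then show "eventually (\<lambda>u. (\<lambda>n. fps_nth (Abs_fps (\<lambda>n. (a gchoose n) * (- 1) ^ n)) n * u ^ n)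
               sums (1 - u) powr a) (nhds 0)"
  proof eventually_elim
    case (elim u)
    then show ?case
      using gen_binomial_complex[of "- u" a] by (simp add: power_minus' mult_ac)
  qed
qed

text \<open>
  The argument \<open>s / (1 - s)\<close> turns each hypergeometric term into a monomial times a power of \<open>1 - s\<close>,
  so only binomial series have to be truncated.
\<close>
lemma maclaurin_trunc_hyp2F1:
  "maclaurin_trunc L (\<lambda>s. (1 - s) powr (- a) * hyp2F1_upto L a b c (v * s / (1 - s))) t
     = (\<Sum>k\<le>L. pochhammer a k * pochhammer b k / pochhammer c k * (v ^ k / fact k) * t ^ k
          * maclaurin_trunc (L - k) (\<lambda>s. (1 - s) powr (- (a + of_nat k))) t)"
proof -
  define C where "C k = pochhammer a k * pochhammer b k / pochhammer c k * (v ^ k / fact k)" for k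
  \<comment> \<open>The identity also holds at \<open>s = 1\<close>, where both sides vanish because \<open>0 powr z = 0\<close>.\<close>
  have powr: "(1 - s) powr (- a) * (v * s / (1 - s)) ^ k
      = v ^ k * (s ^ k * (1 - s) powr (- (a + of_nat k)))" for s :: complex and k
  proof (cases "s = 1")
    case False
    then have "(1 - s) powr (- a - of_nat k) = (1 - s) powr (- a) / (1 - s) ^ k"
      by (simp add: powr_diff powr_nat)
    then show ?thesis
      by (simp add: power_divide power_mult_distrib)
  qed simp
  have eq: "(\<lambda>s. (1 - s) powr (- a) * hyp2F1_upto L a b c (v * s / (1 - s)))
      = (\<lambda>s. \<Sum>k\<le>L. C k * (s ^ k * (1 - s) powr (- (a + of_nat k))))"
  proof
    fix s :: complex
    have "(1 - s) powr (- a) * hyp2F1_upto L a b c (v * s / (1 - s))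
        = (\<Sum>k\<le>L. pochhammer a k * pochhammer b k / pochhammer c k / fact k
             * ((1 - s) powr (- a) * (v * s / (1 - s)) ^ k))"
      by (simp add: hyp2F1_upto_def sum_distrib_left mult_ac)
    then show "(1 - s) powr (- a) * hyp2F1_upto L a b c (v * s / (1 - s))
        = (\<Sum>k\<le>L. C k * (s ^ k * (1 - s) powr (- (a + of_nat k))))"
      unfolding powr by (simp add: C_def mult_ac)
  qed
  have "maclaurin_trunc L (\<lambda>s. (1 - s) powr (- a) * hyp2F1_upto L a b c (v * s / (1 - s))) t
      = (\<Sum>k\<le>L. maclaurin_trunc L (\<lambda>s. C k * (s ^ k * (1 - s) powr (- (a + of_nat k)))) t)"
    unfolding eq
    by (rule maclaurin_trunc_sum, rule has_fps_expansion_cmult_left, rule has_fps_expansion_mult,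
        rule has_fps_expansion_fps_X_power, rule has_fps_expansion_one_minus_powr)
  also have "\<dots> = (\<Sum>k\<le>L. C k * t ^ k
      * maclaurin_trunc (L - k) (\<lambda>s. (1 - s) powr (- (a + of_nat k))) t)"
    by (intro sum.cong refl maclaurin_trunc_cmult_power[OF has_fps_expansion_one_minus_powr]) simp
  finally show ?thesis
    unfolding C_def .
qed

section \<open>The summation formula\<close>

theorem corollary27:
  fixes \<gamma> p q t :: complex and M N n :: nat
  assumes "p \<noteq> 0" and "q \<noteq> 0" and "n \<le> N" and "N \<le> M" and "norm t < 1"
  shows "(\<Sum>x=0..M. of_nat (M choose x) * q ^ x * (1 - q) ^ (M - x)
            * maclaurin_trunc N
                (\<lambda>s. (1 - s) powr (- \<gamma>)
                   * hyp2F1_upto N \<gamma> (- of_nat x) (- of_nat N) (s / (p * (s - 1)))) t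
            * krawtchouk n (of_nat x) q M)
       = pochhammer \<gamma> n / pochhammer (- of_nat N) n * (t * (q - 1) / p) ^ n
            * maclaurin_trunc (N - n)
                (\<lambda>s. (1 - s) powr (- \<gamma> - of_nat n)
                   * hyp2F1_upto (N - n) (\<gamma> + of_nat n) (of_nat n - of_nat M) (of_nat n - of_nat N)
                       (- q * s / (p * (1 - s)))) t"
proof -
  define G where "G k = maclaurin_trunc (N - k) (\<lambda>s. (1 - s) powr (- (\<gamma> + of_nat k))) t" for k
  define w where "w x = of_nat (M choose x) * q ^ x * (1 - q) ^ (M - x)" for x
  define E where "E k = (\<Sum>x\<le>M. w x * of_nat (x choose k) * krawtchouk n (of_nat x) q M)" for k
  define D where "D k = pochhammer \<gamma> k / pochhammer (- of_nat N) k * (t / p) ^ k * G k" for k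
  have nM: "n \<le> M" using assms by simp
  have arg: "s / (p * (s - 1)) = (- 1 / p) * s / (1 - s)" for s
    using assms(1) by (cases "s = 1") (auto simp: field_simps)
  have sgn: "- q * s / (p * (1 - s)) = (- q / p) * s / (1 - s)" for s
    by simp
  have left: "maclaurin_trunc N (\<lambda>s. (1 - s) powr (- \<gamma>)
        * hyp2F1_upto N \<gamma> (- of_nat x) (- of_nat N) (s / (p * (s - 1)))) t
      = (\<Sum>k\<le>N. of_nat (x choose k) * D k)" for x
    unfolding arg maclaurin_trunc_hyp2F1 G_def D_def
    by (intro sum.cong refl)
       (simp add: pochhammer_minus_of_nat[of x] power_divide power_minus' mult_ac)
  have moment: "of_nat (M choose n) * E (n + i)
      = of_nat (M choose n) * (of_nat (M - n choose i) * q ^ i * (q - 1) ^ n)"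
    if "i \<le> N - n" for i
  proof -
    have "(M choose (n + i)) * (n + i choose n) = (M choose n) * (M - n choose i)"
      using choose_mult[of n "n + i" M] that assms by simp
    then have "of_nat (M choose (n + i)) * of_nat (n + i choose n)
        = (of_nat (M choose n) * of_nat (M - n choose i) :: complex)"
      by (metis of_nat_mult)
    moreover have "n + i \<le> M" using that assms by simp
    ultimately show ?thesis
      using krawtchouk_binomial_moment[OF assms(2) nM, of "n + i"]
      by (simp add: E_def w_def mult_ac)
  qed
  have right: "D (n + i) * E (n + i)
      = pochhammer \<gamma> n / pochhammer (- of_nat N) n * (t * (q - 1) / p) ^ n
        * (pochhammer (\<gamma> + of_nat n) i * pochhammer (of_nat n - of_nat M) i
           / pochhammer (of_nat n - of_nat N) i * ((- q / p) ^ i / fact i) * t ^ i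
           * maclaurin_trunc (N - n - i) (\<lambda>s. (1 - s) powr (- (\<gamma> + of_nat n + of_nat i))) t)"
    if "i \<le> N - n" for i
  proof -
    have "E (n + i) = of_nat (M - n choose i) * q ^ i * (q - 1) ^ n"
      using moment[OF that] nM by simp
    moreover have "pochhammer (of_nat n - of_nat M) i = (- 1) ^ i * fact i * (of_nat (M - n choose i) :: complex)"
      using pochhammer_minus_of_nat[of "M - n" i, where ?'a = complex] nM by (simp add: of_nat_diff)
    ultimately show ?thesis
      by (simp add: D_def G_def pochhammer_product' power_add power_divide power_mult_distrib
          power_minus' add.assoc mult_ac)
  qed
  have "(\<Sum>x=0..M. of_nat (M choose x) * q ^ x * (1 - q) ^ (M - x)
            * maclaurin_trunc N
                (\<lambda>s. (1 - s) powr (- \<gamma>)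
                   * hyp2F1_upto N \<gamma> (- of_nat x) (- of_nat N) (s / (p * (s - 1)))) t
            * krawtchouk n (of_nat x) q M)
      = (\<Sum>x\<le>M. \<Sum>k\<le>N. D k * (w x * of_nat (x choose k) * krawtchouk n (of_nat x) q M))"
    unfolding left w_def by (simp add: atLeast0AtMost sum_distrib_left sum_distrib_right mult_ac)
  also have "\<dots> = (\<Sum>k\<le>N. D k * E k)"
    unfolding E_def by (subst sum.swap) (simp add: sum_distrib_left)
  also have "\<dots> = (\<Sum>k\<in>{n..N}. D k * E k)"
  proof (rule sum.mono_neutral_right)
    show "\<forall>k\<in>{..N} - {n..N}. D k * E k = 0"
    proof
      fix k assume "k \<in> {..N} - {n..N}"
      then have "k < n" "k \<le> M" using assms by auto
      then have "of_nat (M choose n) * E k = 0"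
        using krawtchouk_binomial_moment[OF assms(2) nM, of k] by (simp add: E_def w_def)
      then show "D k * E k = 0" using nM by simp
    qed
  qed auto
  also have "\<dots> = (\<Sum>i\<le>N - n. D (n + i) * E (n + i))"
    by (rule sum.reindex_bij_witness[where i = "\<lambda>i. n + i" and j = "\<lambda>k. k - n"])
       (use assms(3) in auto)
  also have "\<dots> = pochhammer \<gamma> n / pochhammer (- of_nat N) n * (t * (q - 1) / p) ^ n
            * maclaurin_trunc (N - n)
                (\<lambda>s. (1 - s) powr (- (\<gamma> + of_nat n))
                   * hyp2F1_upto (N - n) (\<gamma> + of_nat n) (of_nat n - of_nat M) (of_nat n - of_nat N)
                       (- q * s / (p * (1 - s)))) t"
    unfolding sgn maclaurin_trunc_hyp2F1 sum_distrib_left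
    by (intro sum.cong refl right) simp
  finally show ?thesis by simp
qed

end
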